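(* For every $n,k\in\mathbb N$ with $n\ge 2k$, $$ex_<(n,\{\text{Cross-}\mathcal M_k,\text{Sep-}\mathcal M_k\})\le (k-1)n-\binom{2k-1}{2}+\binom{k}{2}+(k-1)\left(\binom{k+1}{2}-1\right).$$ Furthermore, equality holds provided $n\ge 2k^2$.
   Context: An ordered graph on $n$ vertices has vertex set $[n]$ with its natural order. An ordered graph $G$ contains a copy of an ordered graph $H$ if there is an injective, order-preserving map $V(H)\to V(G)$ sending edges to edges. For a family $\mathcal H$ of ordered graphs, $ex_<(n,\mathcal H)$ is the maximum number of edges of an ordered graph on $[n]$ containing no copy of any member of $\mathcal H$. Two vertex-disjoint edges $xy$, $uv$ with $x<y$, $u<v$ are separated if $[x,y]\cap[u,v]=\emptyset$; nested if one interval contains the other; crossing otherwise. A $k$-matching is a set of $k$ pairwise vertex-disjoint edges. $\text{Cross-}\mathcal M_k$ (resp. $\text{Sep-}\mathcal M_k$) is the crossing (resp. separated) $k$-matching, i.e. a $k$-matching every pair of whose edges cross (resp. are separated). Thus the quantity is the maximum number of edges of an ordered graph on $[n]$ containing neither a crossing $k$-matching nor a separated $k$-matching. *)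

theory Defs
  imports Complex_Main
begin

text \<open>An ordered graph on \<open>[n]\<close> is a pair \<open>(n, E)\<close>; the undirected edge with end vertices
  \<open>x < y\<close> is represented by the pair \<open>(x, y)\<close>.\<close>

type_synonym edge = "nat \<times> nat"
type_synonym ograph = "nat \<times> edge set"

definition ordered_graph :: "ograph \<Rightarrow> bool" where
  "ordered_graph G \<longleftrightarrow> (\<forall>(x, y) \<in> snd G. x \<in> {1..fst G} \<and> y \<in> {1..fst G} \<and> x < y)"

definition contains_copy :: "ograph \<Rightarrow> ograph \<Rightarrow> bool" where
  "contains_copy G H \<longleftrightarrow>
     (\<exists>f. f ` {1..fst H} \<subseteq> {1..fst G} \<and> strict_mono_on {1..fst H} f \<and>
          (\<forall>(x, y) \<in> snd H. (f x, f y) \<in> snd G))"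

text \<open>The set is finite, and it is nonempty as soon as every member of the family has an edge.\<close>

definition ex_ord :: "nat \<Rightarrow> ograph set \<Rightarrow> nat" where
  "ex_ord n \<H> =
     Max {card E | E. ordered_graph (n, E) \<and> (\<forall>H\<in>\<H>. \<not> contains_copy (n, E) H)}"

definition vdisjoint :: "edge \<Rightarrow> edge \<Rightarrow> bool" where
  "vdisjoint e f \<longleftrightarrow> {fst e, snd e} \<inter> {fst f, snd f} = {}"

definition separated :: "edge \<Rightarrow> edge \<Rightarrow> bool" where
  "separated e f \<longleftrightarrow> vdisjoint e f \<and> {fst e..snd e} \<inter> {fst f..snd f} = {}"

definition nested :: "edge \<Rightarrow> edge \<Rightarrow> bool" where
  "nested e f \<longleftrightarrow> vdisjoint e f \<and>
     ({fst e..snd e} \<subseteq> {fst f..snd f} \<or> {fst f..snd f} \<subseteq> {fst e..snd e})"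

definition crossing :: "edge \<Rightarrow> edge \<Rightarrow> bool" where
  "crossing e f \<longleftrightarrow> vdisjoint e f \<and> \<not> separated e f \<and> \<not> nested e f"

definition k_matching :: "nat \<Rightarrow> edge set \<Rightarrow> bool" where
  "k_matching k E \<longleftrightarrow> finite E \<and> card E = k \<and> pairwise vdisjoint E"

text \<open>A \<open>k\<close>-matching spans \<open>2k\<close> vertices, so as an ordered graph it lives on \<open>[2k]\<close>. There, the
  pairwise crossing and the pairwise separated one are unique; see \<open>Cross_M_eq\<close> and \<open>Sep_M_eq\<close>.\<close>

definition Cross_M :: "nat \<Rightarrow> ograph" where
  "Cross_M k = (THE H. fst H = 2 * k \<and> ordered_graph H \<and>
                       k_matching k (snd H) \<and> pairwise crossing (snd H))"

definition Sep_M :: "nat \<Rightarrow> ograph" where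
  "Sep_M k = (THE H. fst H = 2 * k \<and> ordered_graph H \<and>
                     k_matching k (snd H) \<and> pairwise separated (snd H))"

lemma separated_iff:
  assumes "fst e < snd e" "fst f < snd f"
  shows "separated e f \<longleftrightarrow> snd e < fst f \<or> snd f < fst e"
proof -
  have "{fst e..snd e} \<inter> {fst f..snd f} = {} \<longleftrightarrow> snd e < fst f \<or> snd f < fst e"
  proof
    assume a: "{fst e..snd e} \<inter> {fst f..snd f} = {}"
    then have "fst f \<notin> {fst e..snd e}" "fst e \<notin> {fst f..snd f}"
      using assms by (auto simp: disjoint_iff)
    then show "snd e < fst f \<or> snd f < fst e" by auto
  qed auto
  then show ?thesis using assms by (auto simp: separated_def vdisjoint_def)
qed

lemma crossing_iff:
  assumes "fst e < snd e" "fst f < snd f"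
  shows "crossing e f \<longleftrightarrow> (fst e < fst f \<and> fst f < snd e \<and> snd e < snd f) \<or>
                          (fst f < fst e \<and> fst e < snd f \<and> snd f < snd e)"
  unfolding crossing_def separated_iff[OF assms] nested_def vdisjoint_def atLeastatMost_subset_iff
  using assms by simp linarith

lemma matching_props:
  assumes "ordered_graph (2 * k, E)" "k_matching k E"
  shows "finite E" "card E = k" "inj_on fst E" "inj_on snd E"
    and "fst ` E \<inter> snd ` E = {}" "fst ` E \<union> snd ` E = {1..2 * k}"
proof -
  have lt: "fst e < snd e" if "e \<in> E" for e
    using assms(1) that by (auto simp: ordered_graph_def)
  have dj: "vdisjoint e f" if "e \<in> E" "f \<in> E" "e \<noteq> f" for e f
    using assms(2) that by (auto simp: k_matching_def pairwise_def)
  show fin: "finite E" and c: "card E = k" using assms(2) by (auto simp: k_matching_def)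
  show i1: "inj_on fst E" and i2: "inj_on snd E"
    by (rule inj_onI; use dj in \<open>fastforce simp: vdisjoint_def\<close>)+
  show d: "fst ` E \<inter> snd ` E = {}"
  proof (rule ccontr)
    assume "fst ` E \<inter> snd ` E \<noteq> {}"
    then obtain e f where "e \<in> E" "f \<in> E" "fst e = snd f" by blast
    then show False using lt[of e] dj[of e f] by (cases "e = f") (auto simp: vdisjoint_def)
  qed
  have "fst ` E \<union> snd ` E \<subseteq> {1..2 * k}" using assms(1) by (fastforce simp: ordered_graph_def)
  moreover have "card (fst ` E \<union> snd ` E) = card {1..2 * k}"
    using fin c d i1 i2 by (simp add: card_Un_disjoint card_image)
  ultimately show "fst ` E \<union> snd ` E = {1..2 * k}" by (simp add: card_subset_eq)
qed

lemma crossing_matching_unique: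
  assumes "ordered_graph (2 * k, E)" "k_matching k E" "pairwise crossing E"
  shows "E = (\<lambda>i. (i, k + i)) ` {1..k}"
proof -
  note P = matching_props[OF assms(1,2)]
  have lt: "fst e < snd e" if "e \<in> E" for e
    using assms(1) that by (auto simp: ordered_graph_def)
  have cr: "(fst e < fst f \<and> fst f < snd e \<and> snd e < snd f) \<or>
            (fst f < fst e \<and> fst e < snd f \<and> snd f < snd e)" if "e \<in> E" "f \<in> E" "e \<noteq> f" for e f
    using assms(3) that lt crossing_iff[of e f] by (auto simp: pairwise_def)
  have LR: "fst e < snd f" if "e \<in> E" "f \<in> E" for e f
    using cr[OF that] lt that by (cases "e = f") auto
  have mono: "fst f < fst e \<longleftrightarrow> snd f < snd e" if "e \<in> E" "f \<in> E" for e f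
    using cr[OF that] by (cases "e = f") auto
  have sub: "E \<subseteq> (\<lambda>i. (i, k + i)) ` {1..k}"
  proof
    fix e assume e: "e \<in> E"
    define A where "A = {f \<in> E. fst f < fst e}"
    have AE: "A \<subseteq> E" by (auto simp: A_def)
    have in1: "fst e \<in> {1..2*k}" "snd e \<in> {1..2*k}" using P(6) e by blast+
    have "fst ` A = {1..<fst e}"
    proof (intro set_eqI iffI)
      fix z assume "z \<in> fst ` A"
      then obtain f where f: "f \<in> E" "z = fst f" "fst f < fst e" by (auto simp: A_def)
      then have "z \<in> {1..2*k}" using P(6) by blast
      then show "z \<in> {1..<fst e}" using f by simp
    next
      fix z assume z: "z \<in> {1..<fst e}"
      then have "z \<in> fst ` E \<union> snd ` E" using P(6) in1 by auto
      then obtain f where f: "f \<in> E" "z = fst f \<or> z = snd f" by blast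
      then have "z = fst f" using LR[OF e f(1)] z by auto
      then show "z \<in> fst ` A" using f z by (auto simp: A_def)
    qed
    moreover have "card (fst ` A) = card A" by (metis card_image inj_on_subset P(3) AE)
    ultimately have c1: "card A = fst e - 1" by simp
    have "fst ` E \<union> snd ` A = {1..<snd e}"
    proof (intro set_eqI iffI)
      fix z assume "z \<in> fst ` E \<union> snd ` A"
      then obtain f where f: "f \<in> E" "z = fst f \<or> (z = snd f \<and> f \<in> A)" by (auto simp: A_def)
      then have "z \<in> {1..2*k}" using P(6) by blast
      moreover have "z < snd e" using f LR[OF f(1) e] mono[OF e f(1)] by (auto simp: A_def)
      ultimately show "z \<in> {1..<snd e}" by simp
    next
      fix z assume z: "z \<in> {1..<snd e}"
      then have "z \<in> fst ` E \<union> snd ` E" using P(6) in1 by auto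
      then obtain f where f: "f \<in> E" "z = fst f \<or> z = snd f" by blast
      then show "z \<in> fst ` E \<union> snd ` A" using mono[OF e f(1)] z by (auto simp: A_def)
    qed
    moreover have "card (snd ` A) = card A" by (metis card_image inj_on_subset P(4) AE)
    moreover have "card (fst ` E \<union> snd ` A) = card (fst ` E) + card (snd ` A)"
      by (rule card_Un_disjoint) (use P(1,5) AE finite_subset in blast)+
    moreover have "card (fst ` E) = k" using P(2,3) by (simp add: card_image)
    ultimately have c2: "k + card A = snd e - 1" by simp
    have "card A < k" using psubset_card_mono[OF P(1), of A] e P(2) by (auto simp: A_def)
    then have "e = (fst e, k + fst e)" "fst e \<in> {1..k}" using c1 c2 in1 by (auto simp: prod_eq_iff)
    then show "e \<in> (\<lambda>i. (i, k + i)) ` {1..k}" by (rule image_eqI)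
  qed
  show ?thesis
    by (rule card_subset_eq[OF _ sub]) (simp_all add: P(2) card_image inj_on_def)
qed

lemma separated_matching_unique:
  assumes "ordered_graph (2 * k, E)" "k_matching k E" "pairwise separated E"
  shows "E = (\<lambda>i. (2 * i - 1, 2 * i)) ` {1..k}"
proof -
  note P = matching_props[OF assms(1,2)]
  have lt: "fst e < snd e" if "e \<in> E" for e
    using assms(1) that by (auto simp: ordered_graph_def)
  have sep: "snd e < fst f \<or> snd f < fst e" if "e \<in> E" "f \<in> E" "e \<noteq> f" for e f
    using assms(3) that lt separated_iff[of e f] by (auto simp: pairwise_def)
  have sub: "E \<subseteq> (\<lambda>i. (2 * i - 1, 2 * i)) ` {1..k}"
  proof
    fix e assume e: "e \<in> E"
    define A where "A = {f \<in> E. snd f < fst e}"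
    have AE: "A \<subseteq> E" by (auto simp: A_def)
    have in1: "fst e \<in> {1..2*k}" "snd e \<in> {1..2*k}" using P(6) e by blast+
    have "fst ` A \<union> snd ` A = {1..<fst e}"
    proof (intro set_eqI iffI)
      fix z assume "z \<in> fst ` A \<union> snd ` A"
      then obtain f where f: "f \<in> A" "z = fst f \<or> z = snd f" by blast
      then have "z \<in> {1..2*k}" using P(6) AE by blast
      then show "z \<in> {1..<fst e}" using f lt[of f] by (auto simp: A_def)
    next
      fix z assume z: "z \<in> {1..<fst e}"
      then have "z \<in> fst ` E \<union> snd ` E" using P(6) in1 by auto
      then obtain f where f: "f \<in> E" "z = fst f \<or> z = snd f" by blast
      then have "e \<noteq> f" using z lt[OF e] by auto
      then have "f \<in> A" using f sep[OF e f(1)] lt[OF e] lt[OF f(1)] z by (auto simp: A_def)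
      then show "z \<in> fst ` A \<union> snd ` A" using f by blast
    qed
    moreover have "card (fst ` A) = card A" "card (snd ` A) = card A"
      by (metis card_image inj_on_subset P(3,4) AE)+
    moreover have "card (fst ` A \<union> snd ` A) = card (fst ` A) + card (snd ` A)"
      by (rule card_Un_disjoint) (use P(1,5) AE finite_subset in blast)+
    ultimately have c1: "2 * card A = fst e - 1" by simp
    have c2: "snd e = fst e + 1"
    proof (rule ccontr)
      assume "snd e \<noteq> fst e + 1"
      then have l: "fst e + 1 < snd e" using lt[OF e] by simp
      then have "fst e + 1 \<in> fst ` E \<union> snd ` E" using P(6) in1 by auto
      then obtain f where f: "f \<in> E" "fst e + 1 = fst f \<or> fst e + 1 = snd f" by blast
      then have "e \<noteq> f" using l by auto
      then show False using f sep[OF e f(1)] l lt[OF f(1)] by auto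
    qed
    have "e \<notin> A" using lt[OF e] by (simp add: A_def)
    then have "card A < k" using psubset_card_mono[OF P(1), of A] e AE P(2) by blast
    then have "e = (2 * (card A + 1) - 1, 2 * (card A + 1))" "card A + 1 \<in> {1..k}"
      using c1 c2 in1 by (auto simp: prod_eq_iff)
    then show "e \<in> (\<lambda>i. (2 * i - 1, 2 * i)) ` {1..k}" by blast
  qed
  show ?thesis
    by (rule card_subset_eq[OF _ sub]) (simp_all add: P(2) card_image inj_on_def)
qed

lemma Cross_M_eq: "Cross_M k = (2 * k, (\<lambda>i. (i, k + i)) ` {1..k})"
  (is "_ = (_, ?E)")
  unfolding Cross_M_def
proof (rule the_equality)
  have "pairwise crossing ?E"
    by (auto simp: pairwise_def crossing_iff)
  moreover from this have "pairwise vdisjoint ?E" by (auto simp: pairwise_def crossing_def)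
  moreover have "card ?E = k" by (simp add: card_image inj_on_def)
  ultimately show "fst (2 * k, ?E) = 2 * k \<and> ordered_graph (2 * k, ?E) \<and>
      k_matching k (snd (2 * k, ?E)) \<and> pairwise crossing (snd (2 * k, ?E))"
    by (auto simp: ordered_graph_def k_matching_def)
next
  fix H assume "fst H = 2 * k \<and> ordered_graph H \<and> k_matching k (snd H) \<and> pairwise crossing (snd H)"
  then show "H = (2 * k, ?E)" using crossing_matching_unique[of k "snd H"] by (cases H) simp
qed

lemma Sep_M_eq: "Sep_M k = (2 * k, (\<lambda>i. (2 * i - 1, 2 * i)) ` {1..k})"
  (is "_ = (_, ?E)")
  unfolding Sep_M_def
proof (rule the_equality)
  have "pairwise separated ?E"
  proof (rule pairwiseI)
    fix e f assume "e \<in> ?E" "f \<in> ?E" "e \<noteq> f"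
    then obtain i j where "e = (2 * i - 1, 2 * i)" "f = (2 * j - 1, 2 * j)" "i \<ge> 1" "j \<ge> 1"
      by auto
    moreover from this have "i \<noteq> j" using \<open>e \<noteq> f\<close> by blast
    ultimately show "separated e f" by (subst separated_iff) auto
  qed
  moreover from this have "pairwise vdisjoint ?E" by (auto simp: pairwise_def separated_def)
  moreover have "card ?E = k" by (simp add: card_image inj_on_def)
  ultimately show "fst (2 * k, ?E) = 2 * k \<and> ordered_graph (2 * k, ?E) \<and>
      k_matching k (snd (2 * k, ?E)) \<and> pairwise separated (snd (2 * k, ?E))"
    by (auto simp: ordered_graph_def k_matching_def)
next
  fix H assume "fst H = 2 * k \<and> ordered_graph H \<and> k_matching k (snd H) \<and> pairwise separated (snd H)"
  then show "H = (2 * k, ?E)" using separated_matching_unique[of k "snd H"] by (cases H) simp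
qed

end

theory Submission
  imports Defs
begin

text \<open>Write \<open>m = k - 1\<close> and call an edge long if its length exceeds \<open>m\<close>, short otherwise.
  If there is no separated \<open>k\<close>-matching, the greedy right end points pierce all edge intervals with
  at most \<open>m\<close> points, and every point lies in at most \<open>(m+2 choose 2) - 1\<close> short edges.
  The long edges are bounded as in the theorem of Capoyleas and Pach on convex geometric graphs
  without \<open>k\<close> pairwise crossing edges: the first \<open>m + 1\<close> vertices are flattened to \<open>m\<close>
  vertices in such a way that only \<open>m\<close> edges are lost and no crossing \<open>k\<close>-matching is created.
  For the lower bound take all long edges that start in \<open>{1..<k}\<close> and all short edges whose interval
  contains a point \<open>i * k\<close> with \<open>1 \<le> i < k\<close>; an edge of a crossing \<open>k\<close>-matching is always long.\<close>

section \<open>Crossing and separated matchings\<close>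

text \<open>A crossing matching as a chain whose edges can be edited one at a time, which the
  flattening argument requires.\<close>

definition has_crossing :: "nat \<Rightarrow> edge set \<Rightarrow> bool" where
  "has_crossing s E \<longleftrightarrow>
     (\<exists>x y. strict_mono_on {..<s} x \<and> strict_mono_on {..<s} y \<and>
            (\<forall>i<s. \<forall>j<s. x i < y j) \<and> (\<forall>i<s. (x i, y i) \<in> E))"

lemma has_crossing_mono: "has_crossing s E \<Longrightarrow> E \<subseteq> F \<Longrightarrow> has_crossing s F"
  unfolding has_crossing_def by blast

lemma has_crossing_imp_contains_copy:
  assumes "ordered_graph (n, E)" and "has_crossing k E"
  shows "contains_copy (n, E) (Cross_M k)"
proof -
  obtain x y where x: "strict_mono_on {..<k} x" and y: "strict_mono_on {..<k} y"
    and xy: "\<And>i j. i < k \<Longrightarrow> j < k \<Longrightarrow> x i < y j"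
    and E: "\<And>i. i < k \<Longrightarrow> (x i, y i) \<in> E"
    using assms(2) unfolding has_crossing_def by blast
  define f where "f j = (if j \<le> k then x (j - 1) else y (j - k - 1))" for j
  have rng: "x i \<in> {1..n} \<and> y i \<in> {1..n}" if "i < k" for i
    using assms(1) E[OF that] by (auto simp: ordered_graph_def)
  have "strict_mono_on {1..2*k} f"
  proof (rule strict_mono_onI)
    fix i j :: nat
    assume ij: "i \<in> {1..2*k}" "j \<in> {1..2*k}" "i < j"
    then consider "j \<le> k" | "i \<le> k" "k < j" | "k < i" by linarith
    then show "f i < f j"
      by cases (use ij in \<open>auto simp: f_def intro!: xy strict_mono_onD[OF x] strict_mono_onD[OF y]\<close>)
  qed
  moreover have "f ` {1..2*k} \<subseteq> {1..n}"
  proof (rule image_subsetI)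
    fix j assume "j \<in> {1..2*k}"
    then show "f j \<in> {1..n}"
      using rng[of "j - 1"] rng[of "j - k - 1"] by (cases "j \<le> k") (auto simp: f_def)
  qed
  moreover have "(f i, f (k + i)) \<in> E" if "i \<in> {1..k}" for i
    using E[of "i - 1"] that by (auto simp: f_def)
  ultimately show ?thesis
    unfolding contains_copy_def Cross_M_eq by (intro exI[of _ f]) auto
qed

lemma separated_list_imp_contains_copy:
  assumes "ordered_graph (n, E)" and "set es \<subseteq> E"
    and "sorted_wrt (\<lambda>e f. snd e < fst f) es" and "k \<le> length es"
  shows "contains_copy (n, E) (Sep_M k)"
proof -
  \<comment> \<open>Vertices \<open>2 * i + 1\<close> and \<open>2 * i + 2\<close> go to the two
    ends of \<open>es ! i\<close>.\<close>
  define f where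
    "f j = (if odd j then fst (es ! ((j - 1) div 2)) else snd (es ! ((j - 1) div 2)))" for j
  have e: "es ! i \<in> E" "fst (es ! i) < snd (es ! i)"
       "fst (es ! i) \<in> {1..n}" "snd (es ! i) \<in> {1..n}" if "i < k" for i
  proof -
    show *: "es ! i \<in> E" using nth_mem[of i es] assms(2,4) that by auto
    show "fst (es ! i) < snd (es ! i)" "fst (es ! i) \<in> {1..n}" "snd (es ! i) \<in> {1..n}"
      using assms(1) * by (auto simp: ordered_graph_def)
  qed
  have sep: "snd (es ! i) < fst (es ! j)" if "i < j" "j < k" for i j
    using sorted_wrt_nth_less[OF assms(3) that(1)] that(2) assms(4) by simp
  have idx: "(j - 1) div 2 < k" if "j \<in> {1..2*k}" for j using that by auto
  have "strict_mono_on {1..2*k} f"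
  proof (rule strict_mono_onI)
    fix i j :: nat
    assume ij: "i \<in> {1..2*k}" "j \<in> {1..2*k}" "i < j"
    let ?i = "(i - 1) div 2" and ?j = "(j - 1) div 2"
    show "f i < f j"
    proof (cases "?i = ?j")
      case True
      moreover have "1 \<le> i" "i < j" using ij by auto
      ultimately have "odd i \<and> even j" by presburger
      then show ?thesis using True e(2)[OF idx[OF ij(2)]] by (simp add: f_def)
    next
      case False
      then have "?i < ?j" using ij div_le_mono[of "i - 1" "j - 1" 2] by simp
      from sep[OF this idx[OF ij(2)]] e(2)[OF idx[OF ij(1)]] e(2)[OF idx[OF ij(2)]]
      show ?thesis by (auto simp: f_def)
    qed
  qed
  moreover have "f ` {1..2*k} \<subseteq> {1..n}"
  proof (rule image_subsetI)
    fix j assume "j \<in> {1..2*k}"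
    from e(3,4)[OF idx[OF this]] show "f j \<in> {1..n}" unfolding f_def by metis
  qed
  moreover have "(f (2 * i - 1), f (2 * i)) \<in> E" if "i \<in> {1..k}" for i
  proof -
    have index: "(2 * i - 1 - 1) div 2 = i - 1" "(2 * i - 1) div 2 = i - 1" "odd (2 * i - 1)"
      using that by (cases i; simp)+
    have "f (2 * i - 1) = fst (es ! (i - 1))" "f (2 * i) = snd (es ! (i - 1))"
      using that index by (auto simp: f_def)
    then show ?thesis using e(1)[of "i - 1"] that by auto
  qed
  ultimately show ?thesis
    unfolding contains_copy_def Sep_M_eq by (intro exI[of _ f]) auto
qed

text \<open>Among the intervals starting at \<open>a\<close> or later take one that ends first. Its
  right end pierces all of them that start no later than this end; the others start past it, so the
  recursion on them adds only edges separated from the chosen one. One list thus yields both a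
  separated matching and a piercing set.\<close>

lemma greedy_piercing:
  fixes E :: "edge set"
  assumes "finite E" and lt: "\<And>x y. (x, y) \<in> E \<Longrightarrow> x < y"
  shows "\<exists>es. set es \<subseteq> {e \<in> E. a \<le> fst e} \<and> sorted_wrt (\<lambda>e f. snd e < fst f) es \<and>
           (\<forall>(x, y) \<in> E. a \<le> x \<longrightarrow> (\<exists>p \<in> snd ` set es. x \<le> p \<and> p \<le> y))"
proof (induction "card {e \<in> E. a \<le> fst e}" arbitrary: a rule: less_induct)
  case less
  let ?A = "{e \<in> E. a \<le> fst e}"
  show ?case
  proof (cases "?A = {}")
    case True
    then show ?thesis by (intro exI[of _ "[]"]) auto
  next
    case False
    have "Min (snd ` ?A) \<in> snd ` ?A" using False assms(1) by (intro Min_in) auto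
    then obtain e where e: "e \<in> ?A" "snd e = Min (snd ` ?A)" by force
    have e_min: "snd e \<le> snd f" if "f \<in> ?A" for f
      unfolding e(2) using assms(1) that by (intro Min_le) auto
    have e_lt: "fst e < snd e" using e(1) lt[of "fst e" "snd e"] by simp
    let ?B = "{f \<in> E. Suc (snd e) \<le> fst f}"
    have "e \<notin> ?B" "?B \<subseteq> ?A" using e(1) e_lt by auto
    then have "?B \<subset> ?A" using e(1) by blast
    then have "card ?B < card ?A" using assms(1) by (intro psubset_card_mono) auto
    from less[OF this] obtain es where es: "set es \<subseteq> ?B" "sorted_wrt (\<lambda>e f. snd e < fst f) es"
      "\<forall>(x, y) \<in> E. Suc (snd e) \<le> x \<longrightarrow> (\<exists>p \<in> snd ` set es. x \<le> p \<and> p \<le> y)" by blast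
    have "\<exists>p \<in> snd ` set (e # es). x \<le> p \<and> p \<le> y" if "(x, y) \<in> E" "a \<le> x" for x y
      using that e_min[of "(x, y)"] es(3) by (cases "x \<le> snd e") fastforce+
    moreover have "set (e # es) \<subseteq> ?A" using es(1) e(1) e_lt by auto
    moreover have "sorted_wrt (\<lambda>e f. snd e < fst f) (e # es)" using es(1,2) by auto
    ultimately show ?thesis by blast
  qed
qed

section \<open>Long edges\<close>

text \<open>The staircase is a greedy chain: each row takes its least right end beyond the value of
  the row before, and a value of \<open>N\<close> or more means that none was left. By minimality no
  edge of a row lies strictly between the previous step and its own.\<close>

lemma greedy_staircase:
  fixes E :: "edge set" and l N :: nat
  assumes "finite E" and E: "snd ` E \<subseteq> {..<N}"
  shows "\<exists>a. (\<forall>i j. l \<le> i \<longrightarrow> i < j \<longrightarrow> a i < a j) \<and>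
    (\<forall>i. l \<le> i \<longrightarrow> a i < N \<longrightarrow> (i, a i) \<in> E) \<and>
    (\<forall>y. (l, y) \<in> E \<longrightarrow> a l \<le> y) \<and>
    (\<forall>i y. l \<le> i \<longrightarrow> (Suc i, y) \<in> E \<longrightarrow> y \<le> a i \<or> a (Suc i) \<le> y)"
proof -
  \<comment> \<open>\<open>N + i\<close> plays the role of infinity.\<close>
  define C where "C i b = insert (N + i) {y. (i, y) \<in> E \<and> b \<le> y}" for i b
  define r where "r = rec_nat (Min (C l 0)) (\<lambda>i b. Min (C (Suc (l + i)) (Suc b)))"
  define a where "a i = r (i - l)" for i
  have fin: "finite (C i b)" for i b
  proof -
    have "{y. (i, y) \<in> E \<and> b \<le> y} \<subseteq> snd ` E" by force
    then show ?thesis using assms(1) by (auto simp: C_def intro: finite_subset)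
  qed
  have N: "y < N" if "(x, y) \<in> E" for x y using E that by force
  have a_l: "a l = Min (C l 0)" by (simp add: a_def r_def)
  have a_Suc: "a (Suc i) = Min (C (Suc i) (Suc (a i)))" if "l \<le> i" for i
    using that by (simp add: a_def r_def Suc_diff_le)
  have mem_l: "a l \<in> C l 0" unfolding a_l by (intro Min_in fin) (auto simp: C_def)
  have mem: "a (Suc i) \<in> C (Suc i) (Suc (a i))" if "l \<le> i" for i
    unfolding a_Suc[OF that] by (intro Min_in fin) (auto simp: C_def)
  \<comment> \<open>The sentinel of a row exceeds every possible value of the row before, so the
    staircase keeps rising even after the edges run out.\<close>
  have le: "a i \<le> N + i" if li: "l \<le> i" for i
  proof (cases "i = l")
    case False
    then obtain j where "i = Suc j" "l \<le> j" using li by (cases i) auto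
    then show ?thesis using mem[of j] N by (fastforce simp: C_def)
  qed (use mem_l N in \<open>fastforce simp: C_def\<close>)
  have step: "a i < a (Suc i)" if "l \<le> i" for i
    using mem[OF that] le[OF that] by (auto simp: C_def)
  show ?thesis
  proof (intro exI[of _ a] conjI allI impI)
    show "a i < a j" if "l \<le> i" "i < j" for i j
      using that(2,1) by (induction rule: strict_inc_induct) (auto intro: step less_trans)
    show "(i, a i) \<in> E" if li: "l \<le> i" and "a i < N" for i
    proof (cases "i = l")
      case False
      then obtain j where "i = Suc j" "l \<le> j" using li by (cases i) auto
      then show ?thesis using mem[of j] \<open>a i < N\<close> by (auto simp: C_def)
    qed (use mem_l that in \<open>auto simp: C_def\<close>)
    show "a l \<le> y" if "(l, y) \<in> E" for y
      unfolding a_l by (intro Min_le fin) (use that in \<open>auto simp: C_def\<close>)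
    show "y \<le> a i \<or> a (Suc i) \<le> y" if "l \<le> i" "(Suc i, y) \<in> E" for i y
    proof (rule disjCI)
      assume "\<not> a (Suc i) \<le> y"
      then have "y \<notin> C (Suc i) (Suc (a i))" using fin that(1) by (auto simp: a_Suc)
      then show "y \<le> a i" using that(2) by (auto simp: C_def)
    qed
  qed
qed

text \<open>Removing vertex \<open>l\<close> costs at most \<open>m\<close> edges: rows are
  rearranged along the greedy staircase, and only edges on it are lost. Its first
  \<open>m + 1\<close> steps cannot all be edges, since these would cross pairwise. A crossing
  matching of the new graph is pulled back to the old one with the help of the staircase.\<close>

lemma flatten_first_vertices:
  fixes E :: "edge set" and l m N :: nat
  assumes E: "\<And>x y. (x, y) \<in> E \<Longrightarrow> l \<le> x \<and> x + m < y \<and> y < N"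
    and no: "\<not> has_crossing (Suc m) E"
  shows "\<exists>E'. (\<forall>x y. (x, y) \<in> E' \<longrightarrow> Suc l \<le> x \<and> x + m < y \<and> y < N) \<and>
    \<not> has_crossing (Suc m) E' \<and> card E \<le> card E' + m"
proof -
  have "E \<subseteq> {..N} \<times> {..N}" using E by fastforce
  then have fin: "finite E" by (rule finite_subset) simp
  have "snd ` E \<subseteq> {..<N}" using E by auto
  from greedy_staircase[OF fin this, of l] obtain a
    where *: "\<forall>i j. l \<le> i \<longrightarrow> i < j \<longrightarrow> a i < a j"
      "\<forall>i. l \<le> i \<longrightarrow> a i < N \<longrightarrow> (i, a i) \<in> E" "\<forall>y. (l, y) \<in> E \<longrightarrow> a l \<le> y"
      "\<forall>i y. l \<le> i \<longrightarrow> (Suc i, y) \<in> E \<longrightarrow> y \<le> a i \<or> a (Suc i) \<le> y" by blast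
  note a_mono = *(1)[rule_format] and a_E = *(2)[rule_format]
    and a_l = *(3)[rule_format] and a_Suc = *(4)[rule_format]
  have a_mono': "a i \<le> a j" if "l \<le> i" "i \<le> j" for i j
    using a_mono[of i j] that by (cases "i = j") auto
  have a_top: "N \<le> a (l + m)"
  proof (rule ccontr)
    assume "\<not> N \<le> a (l + m)"
    then have *: "(l + i, a (l + i)) \<in> E" if "i < Suc m" for i
      using a_E[of "l + i"] a_mono'[of "l + i" "l + m"] that by simp
    have "has_crossing (Suc m) E"
      unfolding has_crossing_def
    proof (intro exI conjI allI impI)
      show "strict_mono_on {..<Suc m} (\<lambda>i. l + i)" "strict_mono_on {..<Suc m} (\<lambda>i. a (l + i))"
        by (auto intro!: strict_mono_onI a_mono)
      \<comment> \<open>The first staircase edge is long, so every right end exceeds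
        \<open>l + m\<close>.\<close>
      show "l + i < a (l + j)" if "i < Suc m" "j < Suc m" for i j
        using E[OF *[of 0]] a_mono'[of l "l + j"] that by simp
    qed (use * in simp)
    then show False using no by simp
  qed
  \<comment> \<open>The edges of row \<open>x\<close> above the staircase \<open>a\<close> are shifted to row \<open>Suc x\<close>, where they meet only
    edges below it; the edges \<open>T\<close> on the staircase are lost.\<close>
  define R where "R = {e \<in> E. l + m < fst e}"
  define H where "H = {(x, y). (x, y) \<in> E \<and> l \<le> x \<and> x < l + m \<and> a x < y}"
  define L where "L = {(x, y). (x, y) \<in> E \<and> l < x \<and> x \<le> l + m \<and> y \<le> a (x - 1)}"
  define H' where "H' = (\<lambda>(x, y). (Suc x, y)) ` H"
  define T where "T = (\<lambda>x. (x, a x)) ` {l..<l + m}"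
  define E' where "E' = R \<union> L \<union> H'"
  have finRLH: "finite R" "finite L" "finite H"
    using fin by (auto simp: R_def L_def H_def intro: finite_subset[OF _ fin])
  have "E \<subseteq> R \<union> L \<union> H \<union> T"
  proof (rule subrelI)
    fix x y assume xy: "(x, y) \<in> E"
    \<comment> \<open>In row \<open>l + m\<close> the staircase has already reached
      \<open>N\<close>, so no edge lies on or above it.\<close>
    have high: "(x, y) \<in> H \<union> T" if "a x \<le> y" "x \<le> l + m"
    proof -
      have "x \<noteq> l + m" using a_top that E[OF xy] by auto
      then show ?thesis using that xy E[OF xy] by (cases "a x = y") (auto simp: H_def T_def)
    qed
    consider "x > l + m" | "x = l" | "l < x" "x \<le> l + m" using E[OF xy] by linarith
    then show "(x, y) \<in> R \<union> L \<union> H \<union> T"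
    proof cases
      case 3
      then show ?thesis using a_Suc[of "x - 1" y] xy high by (auto simp: L_def)
    qed (use xy a_l high in \<open>auto simp: R_def\<close>)
  qed
  then have "card E \<le> card (R \<union> L \<union> H \<union> T)"
    using finRLH by (intro card_mono) (auto simp: T_def)
  also have "\<dots> \<le> card R + card L + card H + card T"
    by (meson add_mono card_Un_le le_trans order_refl)
  also have "card T \<le> m" unfolding T_def using card_image_le[of "{l..<l + m}"] by fastforce
  also have "card H = card H'"
    unfolding H'_def by (rule card_image[symmetric]) (auto simp: inj_on_def)
  also have "card R + card L + card H' = card E'"
  proof -
    have "R \<inter> L = {}" "(R \<union> L) \<inter> H' = {}"
      by (auto simp: R_def L_def H'_def H_def)
    then show ?thesis
      using finRLH by (simp add: E'_def H'_def card_Un_disjoint)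
  qed
  finally have "card E \<le> card E' + m" by simp
  moreover have rng: "Suc l \<le> x \<and> x + m < y \<and> y < N" if xy: "(x, y) \<in> E'" for x y
  proof (cases "(x, y) \<in> R \<union> L")
    case True
    then show ?thesis using E[of x y] by (auto simp: R_def L_def)
  next
    case False
    then obtain z where z: "x = Suc z" "(z, y) \<in> E" "l \<le> z" "a z < y"
      using xy by (auto simp: E'_def H'_def H_def)
    \<comment> \<open>Shifting shortens the edge by one, but it lies strictly above the staircase
      edge of its old row, which is itself long.\<close>
    then show ?thesis using E[OF a_E[of z]] E[of z y] by auto
  qed
  moreover have "\<not> has_crossing (Suc m) E'"
  proof
    assume "has_crossing (Suc m) E'"
    then obtain x y where x: "strict_mono_on {..<Suc m} x" and y: "strict_mono_on {..<Suc m} y"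
      and xy: "\<And>i j. i < Suc m \<Longrightarrow> j < Suc m \<Longrightarrow> x i < y j"
      and inE': "\<And>i. i < Suc m \<Longrightarrow> (x i, y i) \<in> E'"
      unfolding has_crossing_def by blast
    have x_mono: "x i < x j" if "i < j" "j < Suc m" for i j
      using strict_mono_onD[OF x, of i j] that by simp
    have y_mono: "y i < y j" if "i < j" "j < Suc m" for i j
      using strict_mono_onD[OF y, of i j] that by simp
    have gt: "l < x i" if "i < Suc m" for i using rng[OF inE'[OF that]] by simp
    define P where "P u \<longleftrightarrow> u < Suc m \<and> (x u, y u) \<in> H'" for u
    have not_P: "(x u, y u) \<in> E" if "u < Suc m" "\<not> P u" for u
      using inE'[OF that(1)] that by (auto simp: E'_def P_def R_def L_def)
    show False
    proof (cases "\<exists>u. P u")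
      case False
      then have "has_crossing (Suc m) E"
        unfolding has_crossing_def using x y xy not_P by (intro exI[of _ x] exI[of _ y]) auto
      then show False using no by simp
    next
      case True
      moreover have "u \<le> m" if "P u" for u using that by (simp add: P_def)
      ultimately obtain h where h: "P h" "\<And>u. P u \<Longrightarrow> u \<le> h"
        by (metis GreatestI_ex_nat Greatest_le_nat)
      have P_D: "u < Suc m \<and> x u \<le> l + m \<and> (x u - 1, y u) \<in> E \<and> a (x u - 1) < y u" if "P u" for u
        using that by (auto simp: P_def H'_def H_def)
      have hm: "h < Suc m" using h(1) by (simp add: P_def)
      \<comment> \<open>Up to the last edge that came from a shifted row, move every edge back by one row and
        raise it to the staircase; this keeps the chain increasing and its left part only moves
        to the left.\<close>
      define x' where "x' u = (if u \<le> h then x u - 1 else x u)" for u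
      define y' where "y' u = (if u \<le> h then max (y u) (a (x u - 1)) else y u)" for u
      have y'h: "y' h = y h" using P_D[OF h(1)] by (simp add: y'_def)
      \<comment> \<open>At \<open>h\<close> the raise changes nothing, since a shifted edge lies
        above the staircase. So all raised right ends are at most \<open>y h\<close> and precede
        those of the unchanged tail.\<close>
      have y'_le: "y' u \<le> y' h" if "u \<le> h" for u
      proof (cases "u = h")
        case False
        then have "y u < y h" "x u < x h" "l < x u"
          using x_mono y_mono gt[of u] hm that by auto
        moreover from this have "a (x u - 1) \<le> a (x h - 1)" by (intro a_mono') auto
        ultimately show ?thesis using that by (simp add: y'_def max.coboundedI1 max.coboundedI2)
      qed simp
      have "strict_mono_on {..<Suc m} x'"
      proof (rule strict_mono_onI)
        fix i j assume "i \<in> {..<Suc m}" "j \<in> {..<Suc m}" "i < j"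
        then show "x' i < x' j" using x_mono[of i j] gt[of i] by (auto simp: x'_def)
      qed
      moreover have "strict_mono_on {..<Suc m} y'"
      proof (rule strict_mono_onI)
        fix i j assume ij: "i \<in> {..<Suc m}" "j \<in> {..<Suc m}" "i < j"
        have *: "x i < x j" "y i < y j" "l < x i" using ij x_mono y_mono gt by auto
        then have "a (x i - 1) < a (x j - 1)" by (intro a_mono) auto
        moreover have "y' i < y j" if "i \<le> h" "h < j"
          using y'_le[OF that(1)] y'h y_mono[OF that(2)] ij by simp
        ultimately show "y' i < y' j" using * ij by (auto simp: y'_def)
      qed
      moreover have "x' i < y' j" if "i < Suc m" "j < Suc m" for i j
        using xy[OF that] by (auto simp: x'_def y'_def)
      moreover have "(x' u, y' u) \<in> E" if u: "u < Suc m" for u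
      proof (cases "u \<le> h")
        case False
        then show ?thesis using not_P[OF u] h(2)[of u] by (auto simp: x'_def y'_def)
      next
        case uh: True
        show ?thesis
        proof (cases "P u")
          case True
          then show ?thesis using P_D[OF True] uh by (simp add: x'_def y'_def)
        next
          case False
          \<comment> \<open>An edge that comes before \<open>h\<close> in the chain starts too far
            left to be in \<open>R\<close>, so this one is in \<open>L\<close> and the raise lands
            exactly on the staircase. The value stays below \<open>N\<close>, hence it gives a true
            edge of \<open>E\<close>.\<close>
          have "x u \<le> l + m" using x_mono[of u h] P_D[OF h(1)] uh hm by (cases "u = h") auto
          then have "y u \<le> a (x u - 1)"
            using inE'[OF u] False u by (auto simp: E'_def R_def L_def P_def)
          then have eq: "y' u = a (x u - 1)" using uh by (simp add: y'_def)
          have "y' u < N" using y'_le[OF uh] y'h rng[OF inE'[OF hm]] by simp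
          then show ?thesis using a_E[of "x u - 1"] gt[OF u] eq uh by (simp add: x'_def)
        qed
      qed
      ultimately have "has_crossing (Suc m) E"
        unfolding has_crossing_def by blast
      then show False using no by simp
    qed
  qed
  ultimately show ?thesis by blast
qed

text \<open>The coordinates will be distances of end points from reference points, so that a
  condition on edge length becomes a bound on \<open>t + s\<close>.\<close>

lemma card_triangle: "card {(t, s). t + s \<le> (m::nat)} = (m + 2) choose 2"
proof -
  have "{(t, s). t + s \<le> m} = (SIGMA t:{..m}. {..m - t})" by auto
  then have "card {(t, s). t + s \<le> m} = (\<Sum>t\<le>m. Suc (m - t))" by simp
  also have "\<dots> = (\<Sum>t\<le>m. Suc t)"
    using sum.nat_diff_reindex[of Suc "Suc m"] by (simp add: lessThan_Suc_atMost)
  also have "\<dots> = (m + 2) choose 2"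
    by (induction m) (auto simp: numeral_2_eq_2)
  finally show ?thesis .
qed

text \<open>Induction removes the leftmost vertex, at cost \<open>m\<close>, until
  \<open>2 * m + 1\<close> vertices remain; there all pairs of length above \<open>m\<close>
  together number \<open>(m + 1) choose 2\<close>.\<close>

lemma card_long_edges_le:
  fixes E :: "edge set"
  assumes "l + 2 * m + 1 \<le> N" and "\<And>x y. (x, y) \<in> E \<Longrightarrow> l \<le> x \<and> x + m < y \<and> y < N"
    and "\<not> has_crossing (Suc m) E"
  shows "card E \<le> m * (N - l - 2 * m - 1) + ((m + 1) choose 2)"
proof -
  have "l \<le> N - 2 * m - 1" using assms(1) by simp
  then have "\<forall>E. (\<forall>x y. (x, y) \<in> E \<longrightarrow> l \<le> x \<and> x + m < y \<and> y < N) \<longrightarrow>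
      \<not> has_crossing (Suc m) E \<longrightarrow> card E \<le> m * (N - l - 2 * m - 1) + ((m + 1) choose 2)"
  proof (induction rule: inc_induct)
    case base
    show ?case
    proof (intro allI impI)
      fix E :: "edge set"
      let ?l = "N - 2 * m - 1"
      let ?T = "{(t, s). t + s \<le> m - 1}"
      assume E: "\<forall>x y. (x, y) \<in> E \<longrightarrow> ?l \<le> x \<and> x + m < y \<and> y < N"
      have finT: "finite ?T" by (rule finite_subset[of _ "{..m} \<times> {..m}"]) auto
      show "card E \<le> m * (N - ?l - 2 * m - 1) + ((m + 1) choose 2)"
      \<comment> \<open>For \<open>m = 0\<close> the truncated \<open>m - 1\<close> would leave
        \<open>(0, 0)\<close> in \<open>?T\<close>, although there are no edges.\<close>
      proof (cases "m = 0")
        case True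
        then have "E = {}" using E by fastforce
        then show ?thesis by simp
      next
        case False
        have "E \<subseteq> (\<lambda>(t, s). (?l + t, N - 1 - s)) ` ?T"
        proof (rule subrelI)
          fix x y assume "(x, y) \<in> E"
          then have "?l \<le> x" "x + m < y" "y < N" using E by auto
          then show "(x, y) \<in> (\<lambda>(t, s). (?l + t, N - 1 - s)) ` ?T"
            using assms(1) by (intro image_eqI[of _ _ "(x - ?l, N - 1 - y)"]) auto
        qed
        then have "card E \<le> card ?T" using finT by (rule surj_card_le[rotated])
        then show ?thesis using False card_triangle[of "m - 1"] by simp
      qed
    qed
  next
    case (step l)
    show ?case
    proof (intro allI impI)
      fix E :: "edge set"
      assume E: "\<forall>x y. (x, y) \<in> E \<longrightarrow> l \<le> x \<and> x + m < y \<and> y < N" "\<not> has_crossing (Suc m) E"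
      obtain E' where "\<forall>x y. (x, y) \<in> E' \<longrightarrow> Suc l \<le> x \<and> x + m < y \<and> y < N"
        "\<not> has_crossing (Suc m) E'" and E': "card E \<le> card E' + m"
        using flatten_first_vertices[OF E(1)[rule_format] E(2)] by blast
      then have "card E' \<le> m * (N - Suc l - 2 * m - 1) + ((m + 1) choose 2)"
        using step.IH by blast
      with E' have *: "card E \<le> m * (N - Suc l - 2 * m - 1) + ((m + 1) choose 2) + m"
        by linarith
      have eq: "N - l - 2 * m - 1 = Suc (N - Suc l - 2 * m - 1)" using step.hyps by simp
      show "card E \<le> m * (N - l - 2 * m - 1) + ((m + 1) choose 2)"
        unfolding eq mult_Suc_right using * by linarith
    qed
  qed
  then show ?thesis using assms(2,3) by blast
qed

section \<open>Short edges\<close>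

definition short_edges_at :: "nat \<Rightarrow> nat \<Rightarrow> edge set" where
  "short_edges_at m p = {(x, y). x < y \<and> y \<le> x + m \<and> x \<le> p \<and> p \<le> y}"

text \<open>An edge is coded by the distances of its ends from \<open>p\<close>; their sum is its
  length, and \<open>(0, 0)\<close> would be a loop.\<close>

lemma short_edges_at_subset:
  "short_edges_at m p \<subseteq> (\<lambda>(t, s). (p - t, p + s)) ` ({(t, s). t + s \<le> m} - {(0, 0)})"
proof (rule subrelI)
  fix x y assume "(x, y) \<in> short_edges_at m p"
  then show "(x, y) \<in> (\<lambda>(t, s). (p - t, p + s)) ` ({(t, s). t + s \<le> m} - {(0, 0)})"
    by (intro image_eqI[of _ _ "(p - x, y - p)"]) (auto simp: short_edges_at_def)
qed

lemma finite_triangle: "finite {(t, s). t + s \<le> (m::nat)}"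
  by (rule finite_subset[of _ "{..m} \<times> {..m}"]) auto

lemma finite_short_edges_at: "finite (short_edges_at m p)"
  using finite_triangle by (blast intro: finite_subset[OF short_edges_at_subset])

lemma card_short_edges_at_le: "card (short_edges_at m p) \<le> ((m + 2) choose 2) - 1"
proof -
  have "card (short_edges_at m p) \<le> card ({(t, s). t + s \<le> m} - {(0, 0)})"
    using finite_triangle by (intro surj_card_le[OF _ short_edges_at_subset]) auto
  then show ?thesis by (simp add: card_triangle)
qed

text \<open>For \<open>m \<le> p\<close> no subtraction \<open>p - t\<close> is truncated, so the
  coding by distances is a bijection.\<close>

lemma card_short_edges_at:
  assumes "m \<le> p"
  shows "card (short_edges_at m p) = ((m + 2) choose 2) - 1"
proof -
  have "(\<lambda>(t, s). (p - t, p + s)) ` ({(t, s). t + s \<le> m} - {(0, 0)}) \<subseteq> short_edges_at m p"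
    using assms by (auto simp: short_edges_at_def)
  then have "short_edges_at m p = (\<lambda>(t, s). (p - t, p + s)) ` ({(t, s). t + s \<le> m} - {(0, 0)})"
    using short_edges_at_subset by blast
  moreover have "inj_on (\<lambda>(t, s). (p - t, p + s)) ({(t, s). t + s \<le> m} - {(0, 0)})"
    using assms by (auto simp: inj_on_def)
  ultimately show ?thesis by (simp add: card_image card_triangle)
qed

section \<open>The extremal number\<close>

lemma card_le_if_no_copy:
  assumes G: "ordered_graph (n, E)" and n: "2 * m + 1 \<le> n"
    and cross: "\<not> contains_copy (n, E) (Cross_M (Suc m))"
    and sep: "\<not> contains_copy (n, E) (Sep_M (Suc m))"
  shows "card E \<le> m * (n - 2 * m - 1) + ((m + 1) choose 2) + m * (((m + 2) choose 2) - 1)"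
proof -
  have E: "1 \<le> x" "x < y" "y \<le> n" if "(x, y) \<in> E" for x y
    using G that by (auto simp: ordered_graph_def)
  have "E \<subseteq> {..n} \<times> {..n}" using E by fastforce
  then have fin: "finite E" by (rule finite_subset) simp
  define A where "A = {(x, y). (x, y) \<in> E \<and> x + m < y}"
  define B where "B = {(x, y). (x, y) \<in> E \<and> y \<le> x + m}"
  have "A \<subseteq> E" by (auto simp: A_def)
  have "\<not> has_crossing (Suc m) A"
    using has_crossing_imp_contains_copy[OF G] has_crossing_mono[OF _ \<open>A \<subseteq> E\<close>] cross by blast
  \<comment> \<open>The vertices \<open>1\<close> to \<open>n\<close> form the half-open range from
    \<open>1\<close> to \<open>Suc n\<close>.\<close>
  then have "card A \<le> m * (Suc n - 1 - 2 * m - 1) + ((m + 1) choose 2)"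
    using n E by (intro card_long_edges_le) (fastforce simp: A_def)+
  moreover have "card B \<le> m * (((m + 2) choose 2) - 1)"
  proof -
    obtain es where es: "set es \<subseteq> E" "sorted_wrt (\<lambda>e f. snd e < fst f) es"
      "\<forall>(x, y) \<in> E. \<exists>p \<in> snd ` set es. x \<le> p \<and> p \<le> y"
      using greedy_piercing[of E 0] fin E(2) by auto
    have "length es < Suc m"
      using separated_list_imp_contains_copy[OF G es(1,2)] sep by (meson not_less)
    then have "card (snd ` set es) \<le> m"
      by (meson card_image_le card_length finite_set le_trans less_Suc_eq_le)
    have "B \<subseteq> (\<Union>p \<in> snd ` set es. short_edges_at m p)"
      using es(3) E(2) by (fastforce simp: B_def short_edges_at_def)
    then have "card B \<le> card (\<Union>p \<in> snd ` set es. short_edges_at m p)"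
      by (intro card_mono) (auto simp: finite_short_edges_at)
    also have "\<dots> \<le> (\<Sum>p \<in> snd ` set es. card (short_edges_at m p))"
      by (rule card_UN_le) simp
    also have "\<dots> \<le> card (snd ` set es) * (((m + 2) choose 2) - 1)"
      using sum_bounded_above[of "snd ` set es" "\<lambda>p. card (short_edges_at m p)"]
        card_short_edges_at_le by fastforce
    also have "\<dots> \<le> m * (((m + 2) choose 2) - 1)"
      using \<open>card (snd ` set es) \<le> m\<close> by (rule mult_le_mono1)
    finally show ?thesis .
  qed
  moreover have "card E \<le> card A + card B"
  proof -
    have "E = A \<union> B" by (auto simp: A_def B_def)
    then show ?thesis by (metis card_Un_le)
  qed
  ultimately show ?thesis by simp
qed

section \<open>The extremal construction\<close>

definition extremal_edges :: "nat \<Rightarrow> nat \<Rightarrow> edge set" where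
  "extremal_edges n k = {(x, y). 1 \<le> x \<and> x < k \<and> x + k \<le> y \<and> y \<le> n} \<union>
     (\<Union>i \<in> {1..<k}. short_edges_at (k - 1) (i * k))"

lemma strict_mono_on_nat_diff_le:
  fixes f :: "nat \<Rightarrow> nat"
  assumes "strict_mono_on {a..b} f" "a \<le> i" "i \<le> j" "j \<le> b"
  shows "f i + (j - i) \<le> f j"
  using assms(3,4)
proof (induction j rule: dec_induct)
  case (step j)
  then have "f j < f (Suc j)" using assms(1,2) by (auto intro: strict_mono_onD)
  then show ?case using step by simp
qed simp

text \<open>The last edge of a crossing \<open>k\<close>-matching has \<open>k - 1\<close> left ends
  before it and \<open>k - 1\<close> right ends inside it. So it starts at \<open>k\<close> or later
  and has length at least \<open>k\<close>, whereas the long edges of the construction start before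
  \<open>k\<close>.\<close>

lemma extremal_edges_no_crossing:
  assumes "k \<ge> 1"
  shows "\<not> contains_copy (n, extremal_edges n k) (Cross_M k)"
proof
  assume "contains_copy (n, extremal_edges n k) (Cross_M k)"
  then obtain f where f: "f ` {1..2*k} \<subseteq> {1..n}" "strict_mono_on {1..2*k} f"
    "\<forall>i \<in> {1..k}. (f i, f (k + i)) \<in> extremal_edges n k"
    unfolding contains_copy_def Cross_M_eq by auto
  have "f 1 \<in> {1..n}" using f(1) assms by (auto simp: image_subset_iff)
  then have "k \<le> f k" using strict_mono_on_nat_diff_le[OF f(2), of 1 k] assms by simp linarith
  moreover have "f k + k \<le> f (k + k)"
    using strict_mono_on_nat_diff_le[OF f(2), of k "k + k"] assms by simp
  moreover have "(f k, f (k + k)) \<in> extremal_edges n k" using f(3) assms by simp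
  ultimately show False using assms by (auto simp: extremal_edges_def short_edges_at_def)
qed

text \<open>Every edge covers a multiple \<open>c * k\<close> with \<open>1 \<le> c < k\<close>, the
  long ones covering \<open>k\<close> itself. Separated edges need distinct multiples, and only
  \<open>k - 1\<close> are available.\<close>

lemma extremal_edges_no_separated:
  assumes "k \<ge> 1"
  shows "\<not> contains_copy (n, extremal_edges n k) (Sep_M k)"
proof
  assume "contains_copy (n, extremal_edges n k) (Sep_M k)"
  then obtain f where f: "strict_mono_on {1..2*k} f"
    "\<forall>i \<in> {1..k}. (f (2 * i - 1), f (2 * i)) \<in> extremal_edges n k"
    unfolding contains_copy_def Sep_M_eq by auto
  have pierce: "\<exists>c \<in> {1..<k}. x \<le> c * k \<and> c * k \<le> y" if "(x, y) \<in> extremal_edges n k" for x y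
  proof (cases "x < k \<and> k \<le> y")
    case True
    moreover have "1 < k" using that True by (auto simp: extremal_edges_def)
    ultimately show ?thesis by (intro bexI[of _ 1]) auto
  next
    case False
    then show ?thesis using that by (auto simp: extremal_edges_def short_edges_at_def)
  qed
  \<comment> \<open>The bound on the right end carries the induction: the next edge starts beyond
    it, so its multiple is at least \<open>Suc i * k\<close>. At \<open>i = k\<close> the second
    conjunct is absurd.\<close>
  have "i * k \<le> f (2 * i) \<and> i < k" if "1 \<le> i" "i \<le> k" for i
    using that
  proof (induction i rule: nat_induct_at_least)
    case base
    then obtain c where c: "c \<in> {1..<k}" "c * k \<le> f 2"
      using pierce[of "f 1" "f 2"] bspec[OF f(2), of 1] by auto
    from c(1) have "k \<le> c * k" by simp
    from le_trans[OF this c(2)] show ?case using c(1) by simp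
  next
    case (Suc i)
    then have "(f (Suc (2 * i)), f (2 * Suc i)) \<in> extremal_edges n k"
      using bspec[OF f(2), of "Suc i"] by simp
    then obtain c where c: "c \<in> {1..<k}" "f (Suc (2 * i)) \<le> c * k" "c * k \<le> f (2 * Suc i)"
      using pierce by blast
    have "f (2 * i) < f (Suc (2 * i))"
      using Suc by (intro strict_mono_onD[OF f(1)]) auto
    moreover have "i * k \<le> f (2 * i)" using Suc by simp
    ultimately have "i * k < c * k" using c(2) by linarith
    then have "Suc i \<le> c" by simp
    then show ?case using c mult_le_mono1[of "Suc i" c k] by auto
  qed
  from this[of k] show False using assms by simp
qed

text \<open>Short edges reach at most \<open>k - 1\<close> beyond the outermost piercing points
  \<open>k\<close> and \<open>(k - 1) * k\<close>, so they stay between \<open>1\<close> and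
  \<open>n\<close>.\<close>

lemma ordered_graph_extremal_edges:
  assumes "2 * k ^ 2 \<le> n"
  shows "ordered_graph (n, extremal_edges n k)"
proof -
  have "1 \<le> x \<and> x < y \<and> y \<le> n" if "(x, y) \<in> short_edges_at (k - 1) (i * k)" "i \<in> {1..<k}" for x y i
  proof -
    have "i * k \<le> (k - 1) * k" "1 * k \<le> i * k" using that(2) by (intro mult_le_mono1; auto)+
    moreover have "(k - 1) * k + k \<le> 2 * k ^ 2"
      by (cases k) (auto simp: power2_eq_square)
    moreover have "x < y" "y \<le> x + (k - 1)" "x \<le> i * k" "i * k \<le> y" "1 \<le> k"
      using that by (auto simp: short_edges_at_def)
    ultimately show ?thesis using assms by linarith
  qed
  then show ?thesis by (fastforce simp: ordered_graph_def extremal_edges_def)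
qed

lemma card_extremal_edges:
  assumes "2 * Suc m ^ 2 \<le> n"
  shows "card (extremal_edges n (Suc m)) =
    m * (n - 2 * m - 1) + ((m + 1) choose 2) + m * (((m + 2) choose 2) - 1)"
proof -
  let ?k = "Suc m"
  define A where "A = {(x, y). 1 \<le> x \<and> x < ?k \<and> x + ?k \<le> y \<and> y \<le> n}"
  define B where "B = (\<Union>i \<in> {1..<?k}. short_edges_at m (i * ?k))"
  have n: "2 * m + 1 \<le> n" using assms by (simp add: power2_eq_square)
  have A_eq: "A = (SIGMA x:{1..m}. {x + ?k..n})" by (auto simp: A_def)
  have "card A = (\<Sum>x=1..m. n - m - x)" unfolding A_eq by (simp add: card_SigmaI add.commute)
  \<comment> \<open>The part \<open>n - 2 * m - 1\<close> is common to all rows; the excess falls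
    from \<open>m\<close> to \<open>1\<close>.\<close>
  also have "\<dots> = (\<Sum>x=1..m. (n - 2 * m - 1) + (m + 1 - x))"
    using n by (intro sum.cong) auto
  also have "\<dots> = m * (n - 2 * m - 1) + (\<Sum>x=1..m. m + 1 - x)"
    by (simp only: sum.distrib sum_constant) simp
  also have "(\<Sum>x=1..m. m + 1 - x) = (m + 1) choose 2"
  proof -
    have "(\<Sum>x=1..m. m + 1 - x) = \<Sum>{1..m}"
      by (rule sum.reindex_bij_witness[of _ "\<lambda>x. m + 1 - x" "\<lambda>x. m + 1 - x"]) auto
    also have "\<dots> = (m + 1) choose 2" by (induction m) (auto simp: numeral_2_eq_2)
    finally show ?thesis .
  qed
  finally have "card A = m * (n - 2 * m - 1) + ((m + 1) choose 2)" .
  moreover have "card B = m * (((m + 2) choose 2) - 1)"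
  proof -
    \<comment> \<open>Distinct piercing points are at least \<open>m + 1\<close> apart, too far for
      one short edge.\<close>
    have disj: "short_edges_at m (i * ?k) \<inter> short_edges_at m (j * ?k) = {}" if "i < j" for i j
    proof -
      have "i * ?k + ?k \<le> j * ?k" using mult_le_mono1[of "Suc i" j ?k] that by simp
      then show ?thesis by (auto simp: short_edges_at_def)
    qed
    have "card B = (\<Sum>i \<in> {1..<?k}. card (short_edges_at m (i * ?k)))"
      unfolding B_def
    proof (rule card_UN_disjoint)
      show "\<forall>i\<in>{1..<?k}. \<forall>j\<in>{1..<?k}. i \<noteq> j \<longrightarrow>
          short_edges_at m (i * ?k) \<inter> short_edges_at m (j * ?k) = {}"
        by (metis disj inf_commute linorder_neqE_nat)
    qed (auto simp: finite_short_edges_at)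
    also have "\<dots> = (\<Sum>i \<in> {1..<?k}. ((m + 2) choose 2) - 1)"
    proof (intro sum.cong refl card_short_edges_at)
      fix i assume "i \<in> {1..<?k}"
      then show "m \<le> i * ?k" using mult_le_mono1[of 1 i ?k] by simp
    qed
    finally show ?thesis by simp
  qed
  moreover have "card (A \<union> B) = card A + card B"
  proof (rule card_Un_disjoint)
    show "finite A" "finite B" by (auto simp: A_eq B_def finite_short_edges_at)
    show "A \<inter> B = {}" by (auto simp: A_def B_def short_edges_at_def)
  qed
  moreover have "extremal_edges n ?k = A \<union> B" by (simp add: extremal_edges_def A_def B_def)
  ultimately show ?thesis by simp
qed

theorem theorem2p6:
  fixes n k :: nat
  assumes "k \<ge> 1" and "n \<ge> 2 * k"
  shows "int (ex_ord n {Cross_M k, Sep_M k})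
           \<le> (int k - 1) * int n - int ((2 * k - 1) choose 2) + int (k choose 2)
              + (int k - 1) * (int ((k + 1) choose 2) - 1)
       \<and> (n \<ge> 2 * k ^ 2 \<longrightarrow>
            int (ex_ord n {Cross_M k, Sep_M k})
             = (int k - 1) * int n - int ((2 * k - 1) choose 2) + int (k choose 2)
                + (int k - 1) * (int ((k + 1) choose 2) - 1))"
proof -
  obtain m where k: "k = Suc m" using assms(1) by (cases k) auto
  have n: "2 * m + 1 \<le> n" using assms(2) k by simp
  define b where "b = m * (n - 2 * m - 1) + ((m + 1) choose 2) + m * (((m + 2) choose 2) - 1)"
  define S where "S = {card E | E. ordered_graph (n, E) \<and>
    (\<forall>H\<in>{Cross_M k, Sep_M k}. \<not> contains_copy (n, E) H)}"
  have ex: "ex_ord n {Cross_M k, Sep_M k} = Max S" by (simp add: ex_ord_def S_def)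
  have le: "c \<le> b" if "c \<in> S" for c
    using that card_le_if_no_copy[OF _ n] by (auto simp: S_def b_def k)
  have fin: "finite S" using le by (meson finite_nat_set_iff_bounded_le)
  \<comment> \<open>The empty graph makes \<open>S\<close> nonempty, so that \<open>Max S\<close> is
    a genuine maximum.\<close>
  have "ordered_graph (n, {})" by (simp add: ordered_graph_def)
  moreover have "\<forall>H\<in>{Cross_M k, Sep_M k}. \<not> contains_copy (n, {}) H"
    using assms(1) by (fastforce simp: contains_copy_def Cross_M_eq Sep_M_eq)
  ultimately have "S \<noteq> {}" unfolding S_def by blast
  then have upper: "Max S \<le> b" using fin le by simp
  have lower: "b \<le> Max S" if "n \<ge> 2 * k ^ 2"
  proof (rule Max_ge[OF fin])
    have "card (extremal_edges n k) \<in> S"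
      unfolding S_def
      using ordered_graph_extremal_edges[OF that] extremal_edges_no_crossing[OF assms(1)]
        extremal_edges_no_separated[OF assms(1)] by blast
    then show "b \<in> S" using card_extremal_edges[of m n] that by (simp add: k b_def)
  qed
  have "int b = (int k - 1) * int n - int ((2 * k - 1) choose 2) + int (k choose 2)
      + (int k - 1) * (int ((k + 1) choose 2) - 1)"
  proof -
    \<comment> \<open>This identity turns \<open>m * (n - 2 * m - 1)\<close> into
      \<open>(k - 1) * n\<close> minus \<open>(2 * k - 1) choose 2\<close>.\<close>
    have c1: "(2 * m + 1) choose 2 = m * (2 * m + 1)" by (simp add: choose_two)
    have "1 \<le> (m + 2) choose 2" by (simp add: Suc_le_eq)
    then have "int b = int m * (int n - 2 * int m - 1) + int ((m + 1) choose 2)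
        + int m * (int ((m + 2) choose 2) - 1)"
      using n by (simp add: b_def of_nat_diff)
    moreover have "2 * k - 1 = 2 * m + 1" "k + 1 = m + 2" "int k - 1 = int m" "k = m + 1"
      by (simp_all add: k)
    ultimately show ?thesis by (simp only: c1) (simp add: algebra_simps)
  qed
  then show ?thesis using upper lower unfolding ex by auto
qed

end
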